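(* Let $(M^{2n+1},\varphi,Q,\xi,\eta,g)$ be a weak almost contact B-metric manifold with contact distribution $\mathcal{D}=\operatorname{Ker}\eta$, and let $\nabla$ denote the Levi-Civita connection of $g$. If $$d\eta(X,Y)=g(\nabla_X\xi,Y)\quad\text{for all } X,Y\in\chi(M),$$ then $\xi$ is Killing (i.e. $\mathcal{L}_\xi g=0$) and $\mathcal{D}$ is parallel (i.e. $\nabla_XY\in\Gamma(\mathcal{D})$ for all $X\in\chi(M)$, $Y\in\Gamma(\mathcal{D})$).
   Context: $\chi(M)$ denotes the smooth vector fields on $M$ and $\Gamma(\mathcal{D})$ the smooth sections of a distribution $\mathcal{D}$. The exterior derivative convention is $d\eta(X,Y)=X(\eta(Y))-Y(\eta(X))-\eta([X,Y])$. A smooth manifold $M^{2n+1}$ ($n\ge 1$) carries a weak almost contact structure $(\varphi,Q,\xi,\eta)$ if it admits a $(1,1)$-tensor field $\varphi$, a nonsingular $(1,1)$-tensor field $Q$, a vector field $\xi$ and a 1-form $\eta$ such that $\varphi^2=-Q+\eta\otimes\xi$, $\eta(\xi)=1$, $Q\xi=\xi$, and $\mathcal{D}:=\operatorname{Ker}\eta$ (the contact distribution) is $\varphi$-invariant, i.e. $\varphi(\mathcal{D})\subset\mathcal{D}$. Here $(\eta\otimes\xi)(X)=\eta(X)\xi$. If moreover $g$ is a (semi-)Riemannian metric on $M$ (Riemannian or indefinite) with $g(\varphi X,\varphi Y)=-g(X,QY)+\eta(X)\eta(Y)$ for all $X,Y\in\chi(M)$, then $(M^{2n+1},\varphi,Q,\xi,\eta,g)$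 is called a weak almost contact B-metric manifold. *)

theory Defs
  imports "HOL-Analysis.Analysis" "HOL-Library.Function_Algebras"
begin

section \<open>Smooth manifolds\<close>

text \<open>
  \<open>Ck_on k S f\<close> is intended for open \<open>S\<close>: all iterated directional derivatives of \<open>f\<close> up to
  order \<open>k\<close> exist on \<open>S\<close> (those of order less than \<open>k\<close> as Frechet differentiable functions)
  and are continuous there.
\<close>

primrec Ck_on :: "nat \<Rightarrow> 'e::euclidean_space set \<Rightarrow> ('e \<Rightarrow> 'f::real_normed_vector) \<Rightarrow> bool" where
  "Ck_on 0 S f \<longleftrightarrow> continuous_on S f"
| "Ck_on (Suc k) S f \<longleftrightarrow>
     (\<forall>x\<in>S. f differentiable (at x)) \<and> (\<forall>v. Ck_on k S (\<lambda>x. frechet_derivative f (at x) v))"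

definition smooth_on :: "'e::euclidean_space set \<Rightarrow> ('e \<Rightarrow> 'f::real_normed_vector) \<Rightarrow> bool" where
  "smooth_on S f \<longleftrightarrow> (\<forall>k. Ck_on k S f)"

text \<open>
  A chart is a pair \<open>(U, x)\<close> of its domain and its coordinate map; only the values of \<open>x\<close> on \<open>U\<close>
  matter. The manifold is the whole type \<open>'a\<close>, and its dimension is \<open>DIM('e)\<close>.
\<close>

type_synonym ('a, 'e) atlas = "('a set \<times> ('a \<Rightarrow> 'e)) set"

definition chart :: "'a::topological_space set \<Rightarrow> ('a \<Rightarrow> 'e::euclidean_space) \<Rightarrow> bool" where
  "chart U x \<longleftrightarrow> open U \<and> open (x ` U) \<and> homeomorphism U (x ` U) x (inv_into U x)"

definition smooth_atlas ::
    "('a::{t2_space, second_countable_topology}, 'e::euclidean_space) atlas \<Rightarrow> bool" where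
  "smooth_atlas A \<longleftrightarrow>
     (\<forall>(U, x)\<in>A. chart U x) \<and>
     (\<Union>(U, x)\<in>A. U) = UNIV \<and>
     (\<forall>(U, x)\<in>A. \<forall>(V, y)\<in>A. smooth_on (x ` (U \<inter> V)) (y \<circ> inv_into U x))"

definition smooth_fun :: "('a, 'e::euclidean_space) atlas \<Rightarrow> ('a \<Rightarrow> real) set" where
  "smooth_fun A = {f. \<forall>(U, x)\<in>A. smooth_on (x ` U) (f \<circ> inv_into U x)}"


section \<open>Tangent vectors, vector fields and tensor fields\<close>

text \<open>
  Tangent vectors at \<open>p\<close> are the derivations at \<open>p\<close> of the algebra of smooth functions. Being total
  functions in HOL, they are required to vanish on non-smooth arguments, so that a tangent vector is
  determined by its action on smooth functions. Addition, negation and multiplication of functions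
  are pointwise.
\<close>

type_synonym 'a tvec = "('a \<Rightarrow> real) \<Rightarrow> real"

type_synonym 'a vfield = "'a \<Rightarrow> 'a tvec"

definition tscale :: "real \<Rightarrow> 'a tvec \<Rightarrow> 'a tvec"  (infixr "*\<^sub>T" 75) where
  "c *\<^sub>T v = (\<lambda>f. c * v f)"

definition tangent_space :: "('a, 'e::euclidean_space) atlas \<Rightarrow> 'a \<Rightarrow> 'a tvec set" where
  "tangent_space A p = {v.
     (\<forall>f. f \<notin> smooth_fun A \<longrightarrow> v f = 0) \<and>
     (\<forall>f\<in>smooth_fun A. \<forall>h\<in>smooth_fun A. v (f + h) = v f + v h) \<and>
     (\<forall>c. \<forall>f\<in>smooth_fun A. v (\<lambda>q. c * f q) = c * v f) \<and>
     (\<forall>f\<in>smooth_fun A. \<forall>h\<in>smooth_fun A. v (f * h) = f p * v h + h p * v f)}"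

definition act :: "'a vfield \<Rightarrow> ('a \<Rightarrow> real) \<Rightarrow> 'a \<Rightarrow> real" where
  "act X f = (\<lambda>p. X p f)"

definition vector_fields :: "('a, 'e::euclidean_space) atlas \<Rightarrow> 'a vfield set" where
  "vector_fields A = {X.
     (\<forall>p. X p \<in> tangent_space A p) \<and> (\<forall>f\<in>smooth_fun A. act X f \<in> smooth_fun A)}"

definition lie_bracket ::
    "('a, 'e::euclidean_space) atlas \<Rightarrow> 'a vfield \<Rightarrow> 'a vfield \<Rightarrow> 'a vfield" where
  "lie_bracket A X Y =
     (\<lambda>p f. if f \<in> smooth_fun A then X p (act Y f) - Y p (act X f) else 0)"

text \<open>
  Tensor fields are families of (multi)linear maps on the tangent spaces; smoothness means that they
  take smooth vector fields to smooth objects. Their values outside the tangent spaces are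
  irrelevant.
\<close>

type_synonym 'a form1 = "'a \<Rightarrow> 'a tvec \<Rightarrow> real"

type_synonym 'a form2 = "'a \<Rightarrow> 'a tvec \<Rightarrow> 'a tvec \<Rightarrow> real"

type_synonym 'a endo = "'a \<Rightarrow> 'a tvec \<Rightarrow> 'a tvec"

definition one_form :: "('a, 'e::euclidean_space) atlas \<Rightarrow> 'a form1 \<Rightarrow> bool" where
  "one_form A \<eta> \<longleftrightarrow>
     (\<forall>p. \<forall>v\<in>tangent_space A p. \<forall>w\<in>tangent_space A p. \<eta> p (v + w) = \<eta> p v + \<eta> p w) \<and>
     (\<forall>p c. \<forall>v\<in>tangent_space A p. \<eta> p (c *\<^sub>T v) = c * \<eta> p v) \<and>
     (\<forall>X\<in>vector_fields A. (\<lambda>p. \<eta> p (X p)) \<in> smooth_fun A)"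

definition tensor_field_11 :: "('a, 'e::euclidean_space) atlas \<Rightarrow> 'a endo \<Rightarrow> bool" where
  "tensor_field_11 A \<phi> \<longleftrightarrow>
     (\<forall>p. \<forall>v\<in>tangent_space A p. \<phi> p v \<in> tangent_space A p) \<and>
     (\<forall>p. \<forall>v\<in>tangent_space A p. \<forall>w\<in>tangent_space A p. \<phi> p (v + w) = \<phi> p v + \<phi> p w) \<and>
     (\<forall>p c. \<forall>v\<in>tangent_space A p. \<phi> p (c *\<^sub>T v) = c *\<^sub>T \<phi> p v) \<and>
     (\<forall>X\<in>vector_fields A. (\<lambda>p. \<phi> p (X p)) \<in> vector_fields A)"

definition nonsingular :: "('a, 'e::euclidean_space) atlas \<Rightarrow> 'a endo \<Rightarrow> bool" where
  "nonsingular A Q \<longleftrightarrow> (\<forall>p. bij_betw (Q p) (tangent_space A p) (tangent_space A p))"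

text \<open>Riemannian metrics and metrics of indefinite signature are both included.\<close>

definition semi_riemannian_metric :: "('a, 'e::euclidean_space) atlas \<Rightarrow> 'a form2 \<Rightarrow> bool" where
  "semi_riemannian_metric A g \<longleftrightarrow>
     (\<forall>p. \<forall>u\<in>tangent_space A p. \<forall>v\<in>tangent_space A p. \<forall>w\<in>tangent_space A p.
        g p (u + v) w = g p u w + g p v w) \<and>
     (\<forall>p c. \<forall>v\<in>tangent_space A p. \<forall>w\<in>tangent_space A p. g p (c *\<^sub>T v) w = c * g p v w) \<and>
     (\<forall>p. \<forall>v\<in>tangent_space A p. \<forall>w\<in>tangent_space A p. g p v w = g p w v) \<and>
     (\<forall>p. \<forall>v\<in>tangent_space A p. (\<forall>w\<in>tangent_space A p. g p v w = 0) \<longrightarrow> v = 0) \<and>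
     (\<forall>X\<in>vector_fields A. \<forall>Y\<in>vector_fields A. (\<lambda>p. g p (X p) (Y p)) \<in> smooth_fun A)"

definition ext_deriv ::
    "('a, 'e::euclidean_space) atlas \<Rightarrow> 'a form1 \<Rightarrow> 'a vfield \<Rightarrow> 'a vfield \<Rightarrow> 'a \<Rightarrow> real" where
  "ext_deriv A \<eta> X Y = (\<lambda>p.
     X p (\<lambda>q. \<eta> q (Y q)) - Y p (\<lambda>q. \<eta> q (X q)) - \<eta> p (lie_bracket A X Y p))"

text \<open>\<open>(L\<^sub>Z g)(X, Y) = Z (g(X, Y)) - g([Z, X], Y) - g(X, [Z, Y])\<close>\<close>

definition lie_deriv_metric ::
    "('a, 'e::euclidean_space) atlas \<Rightarrow> 'a vfield \<Rightarrow> 'a form2 \<Rightarrow> 'a vfield \<Rightarrow> 'a vfield \<Rightarrow> 'a \<Rightarrow> real" where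
  "lie_deriv_metric A Z g X Y = (\<lambda>p.
     Z p (\<lambda>q. g q (X q) (Y q)) - g p (lie_bracket A Z X p) (Y p) - g p (X p) (lie_bracket A Z Y p))"

definition killing :: "('a, 'e::euclidean_space) atlas \<Rightarrow> 'a form2 \<Rightarrow> 'a vfield \<Rightarrow> bool" where
  "killing A g Z \<longleftrightarrow>
     (\<forall>X\<in>vector_fields A. \<forall>Y\<in>vector_fields A. \<forall>p. lie_deriv_metric A Z g X Y p = 0)"


section \<open>Connections and distributions\<close>

definition affine_connection ::
    "('a, 'e::euclidean_space) atlas \<Rightarrow> ('a vfield \<Rightarrow> 'a vfield \<Rightarrow> 'a vfield) \<Rightarrow> bool" where
  "affine_connection A nabla \<longleftrightarrow>
     (\<forall>X\<in>vector_fields A. \<forall>Y\<in>vector_fields A. nabla X Y \<in> vector_fields A) \<and>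
     (\<forall>X\<in>vector_fields A. \<forall>X'\<in>vector_fields A. \<forall>Y\<in>vector_fields A.
        nabla (X + X') Y = nabla X Y + nabla X' Y) \<and>
     (\<forall>f\<in>smooth_fun A. \<forall>X\<in>vector_fields A. \<forall>Y\<in>vector_fields A.
        nabla (\<lambda>p. f p *\<^sub>T X p) Y = (\<lambda>p. f p *\<^sub>T nabla X Y p)) \<and>
     (\<forall>X\<in>vector_fields A. \<forall>Y\<in>vector_fields A. \<forall>Y'\<in>vector_fields A.
        nabla X (Y + Y') = nabla X Y + nabla X Y') \<and>
     (\<forall>f\<in>smooth_fun A. \<forall>X\<in>vector_fields A. \<forall>Y\<in>vector_fields A.
        nabla X (\<lambda>p. f p *\<^sub>T Y p) = (\<lambda>p. X p f *\<^sub>T Y p + f p *\<^sub>T nabla X Y p))"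

definition levi_civita ::
    "('a, 'e::euclidean_space) atlas \<Rightarrow> 'a form2 \<Rightarrow> ('a vfield \<Rightarrow> 'a vfield \<Rightarrow> 'a vfield) \<Rightarrow> bool" where
  "levi_civita A g nabla \<longleftrightarrow>
     affine_connection A nabla \<and>
     (\<forall>X\<in>vector_fields A. \<forall>Y\<in>vector_fields A. nabla X Y - nabla Y X = lie_bracket A X Y) \<and>
     (\<forall>X\<in>vector_fields A. \<forall>Y\<in>vector_fields A. \<forall>Z\<in>vector_fields A. \<forall>p.
        X p (\<lambda>q. g q (Y q) (Z q)) = g p (nabla X Y p) (Z p) + g p (Y p) (nabla X Z p))"

definition ker_form :: "('a, 'e::euclidean_space) atlas \<Rightarrow> 'a form1 \<Rightarrow> 'a \<Rightarrow> 'a tvec set" where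
  "ker_form A \<eta> p = {v \<in> tangent_space A p. \<eta> p v = 0}"

definition sections ::
    "('a, 'e::euclidean_space) atlas \<Rightarrow> ('a \<Rightarrow> 'a tvec set) \<Rightarrow> 'a vfield set" where
  "sections A D = {X \<in> vector_fields A. \<forall>p. X p \<in> D p}"

definition parallel_distribution ::
    "('a, 'e::euclidean_space) atlas \<Rightarrow> ('a vfield \<Rightarrow> 'a vfield \<Rightarrow> 'a vfield) \<Rightarrow>
     ('a \<Rightarrow> 'a tvec set) \<Rightarrow> bool" where
  "parallel_distribution A nabla D \<longleftrightarrow>
     (\<forall>X\<in>vector_fields A. \<forall>Y\<in>sections A D. nabla X Y \<in> sections A D)"


section \<open>Weak almost contact B-metric manifolds\<close>

definition weak_almost_contact ::
    "('a, 'e::euclidean_space) atlas \<Rightarrow> 'a endo \<Rightarrow> 'a endo \<Rightarrow> 'a vfield \<Rightarrow> 'a form1 \<Rightarrow> bool" where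
  "weak_almost_contact A \<phi> Q \<xi> \<eta> \<longleftrightarrow>
     tensor_field_11 A \<phi> \<and> tensor_field_11 A Q \<and> nonsingular A Q \<and>
     \<xi> \<in> vector_fields A \<and> one_form A \<eta> \<and>
     (\<forall>p. \<forall>v\<in>tangent_space A p. \<phi> p (\<phi> p v) = - Q p v + \<eta> p v *\<^sub>T \<xi> p) \<and>
     (\<forall>p. \<eta> p (\<xi> p) = 1) \<and>
     (\<forall>p. Q p (\<xi> p) = \<xi> p) \<and>
     (\<forall>p. \<phi> p ` ker_form A \<eta> p \<subseteq> ker_form A \<eta> p)"

definition weak_almost_contact_B_metric ::
    "('a, 'e::euclidean_space) atlas \<Rightarrow> 'a endo \<Rightarrow> 'a endo \<Rightarrow> 'a vfield \<Rightarrow> 'a form1 \<Rightarrow> 'a form2 \<Rightarrow> bool"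
  where
  "weak_almost_contact_B_metric A \<phi> Q \<xi> \<eta> g \<longleftrightarrow>
     weak_almost_contact A \<phi> Q \<xi> \<eta> \<and>
     semi_riemannian_metric A g \<and>
     (\<forall>X\<in>vector_fields A. \<forall>Y\<in>vector_fields A. \<forall>p.
        g p (\<phi> p (X p)) (\<phi> p (Y p)) = - g p (X p) (Q p (Y p)) + \<eta> p (X p) * \<eta> p (Y p))"

end

theory Submission
  imports Defs
begin

text \<open>
  The structure forces \<open>\<phi> \<xi> = 0\<close> (\<open>structure_endo_Reeb\<close>), so putting \<open>Y = \<xi>\<close> in the
  compatibility condition of the metric gives \<open>\<eta> = g(\<cdot>, \<xi>)\<close> (\<open>form_eq_metric_Reeb\<close>). For the
  metric dual of any vector field, a torsion-free metric connection satisfies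
  \<open>d\<eta>(X, Y) = g(\<nabla>\<^sub>X \<xi>, Y) - g(X, \<nabla>\<^sub>Y \<xi>)\<close> (\<open>ext_deriv_metric_dual\<close>). The hypothesis
  \<open>d\<eta>(X, Y) = g(\<nabla>\<^sub>X \<xi>, Y)\<close> therefore says exactly that \<open>g(X, \<nabla>\<^sub>Y \<xi>)\<close> vanishes for all
  vector fields, that is, \<open>\<xi>\<close> is parallel.

  Both conclusions are general facts about a parallel field. It is Killing, because
  \<open>(L\<^sub>\<xi> g)(X, Y) = g(\<nabla>\<^sub>X \<xi>, Y) + g(X, \<nabla>\<^sub>Y \<xi>)\<close> (\<open>lie_deriv_metric_levi_civita\<close>). Its
  orthogonal complement is parallel, because \<open>g(\<nabla>\<^sub>X Y, \<xi>) = X (g(Y, \<xi>)) - g(Y, \<nabla>\<^sub>X \<xi>)\<close> and both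
  terms vanish when \<open>Y\<close> is orthogonal to \<open>\<xi>\<close>.
\<close>

section \<open>Pointwise linear algebra\<close>

lemma tangent_space_add:
  assumes "v \<in> tangent_space A p" "w \<in> tangent_space A p"
  shows "v + w \<in> tangent_space A p"
  using assms by (simp add: tangent_space_def algebra_simps)

lemma tangent_space_tscale:
  assumes "v \<in> tangent_space A p"
  shows "c *\<^sub>T v \<in> tangent_space A p"
  using assms by (simp add: tangent_space_def tscale_def algebra_simps)

lemma tscale_minus_one: "(-1) *\<^sub>T v = - v"
  by (simp add: tscale_def fun_eq_iff)

lemma tscale_zero: "0 *\<^sub>T v = 0"
  by (simp add: tscale_def fun_eq_iff)

lemma tangent_space_uminus:
  assumes "v \<in> tangent_space A p"
  shows "- v \<in> tangent_space A p"
  using tangent_space_tscale[OF assms, of "-1"] by (simp add: tscale_minus_one)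

text \<open>
  If the zero function is smooth, homogeneity gives the claim; otherwise it is the convention that
  tangent vectors vanish on non-smooth functions.
\<close>

lemma tangent_vector_zero_fun:
  assumes "v \<in> tangent_space A p"
  shows "v (\<lambda>q. 0) = 0"
proof (cases "(\<lambda>q. 0) \<in> smooth_fun A")
  case True
  have "v (\<lambda>q. c * f q) = c * v f" if "f \<in> smooth_fun A" for c f
    using assms that unfolding tangent_space_def by blast
  from this[OF True, of 0] show ?thesis by simp
next
  case False
  then show ?thesis
    using assms unfolding tangent_space_def by blast
qed

lemma vector_fields_tangent:
  assumes "X \<in> vector_fields A"
  shows "X p \<in> tangent_space A p"
  using assms by (simp add: vector_fields_def)

lemma one_form_diff:
  assumes "one_form A \<eta>" and v: "v \<in> tangent_space A p" and w: "w \<in> tangent_space A p"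
  shows "\<eta> p (v - w) = \<eta> p v - \<eta> p w"
proof -
  have "\<eta> p (v + - w) = \<eta> p v + \<eta> p (- w)"
    using assms(1) v tangent_space_uminus[OF w] unfolding one_form_def by blast
  moreover have "\<eta> p ((-1) *\<^sub>T w) = - 1 * \<eta> p w"
    using assms(1) w unfolding one_form_def by blast
  ultimately show ?thesis by (simp add: tscale_minus_one)
qed

lemma metric_sym:
  assumes "semi_riemannian_metric A g" "v \<in> tangent_space A p" "w \<in> tangent_space A p"
  shows "g p v w = g p w v"
  using assms(1)[unfolded semi_riemannian_metric_def, THEN conjunct2, THEN conjunct2, THEN conjunct1]
    assms(2,3) by blast

lemma metric_diff_left:
  assumes "semi_riemannian_metric A g"
    and u: "u \<in> tangent_space A p" and v: "v \<in> tangent_space A p" and w: "w \<in> tangent_space A p"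
  shows "g p (u - v) w = g p u w - g p v w"
proof -
  note linear = assms(1)[unfolded semi_riemannian_metric_def]
  have "g p (u + - v) w = g p u w + g p (- v) w"
    using linear[THEN conjunct1] u tangent_space_uminus[OF v] w by blast
  moreover have "g p ((-1) *\<^sub>T v) w = - 1 * g p v w"
    using linear[THEN conjunct2, THEN conjunct1] v w by blast
  ultimately show ?thesis by (simp add: tscale_minus_one)
qed

lemma metric_zero_left:
  assumes "semi_riemannian_metric A g" "w \<in> tangent_space A p"
  shows "g p 0 w = 0"
  using metric_diff_left[OF assms(1) assms(2) assms(2) assms(2)] by simp

section \<open>The Levi-Civita connection\<close>

lemma levi_civita_vector_field:
  assumes "levi_civita A g nabla" "X \<in> vector_fields A" "Y \<in> vector_fields A"
  shows "nabla X Y \<in> vector_fields A"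
  using assms by (simp add: levi_civita_def affine_connection_def)

lemma levi_civita_lie_bracket:
  assumes "levi_civita A g nabla" "X \<in> vector_fields A" "Y \<in> vector_fields A"
  shows "lie_bracket A X Y p = nabla X Y p - nabla Y X p"
proof -
  have "nabla X Y - nabla Y X = lie_bracket A X Y"
    using assms unfolding levi_civita_def by blast
  then have "lie_bracket A X Y = nabla X Y - nabla Y X" ..
  then show ?thesis by (simp only: minus_apply)
qed

lemma levi_civita_metric:
  assumes "levi_civita A g nabla"
    "X \<in> vector_fields A" "Y \<in> vector_fields A" "Z \<in> vector_fields A"
  shows "X p (\<lambda>q. g q (Y q) (Z q)) = g p (nabla X Y p) (Z p) + g p (Y p) (nabla X Z p)"
  using assms unfolding levi_civita_def by blast

text \<open>
  The covariant derivatives of \<open>X\<close> and \<open>Y\<close> produced by the product rule cancel against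
  \<open>\<eta>([X, Y])\<close> because the connection has no torsion.
\<close>

lemma ext_deriv_metric_dual:
  assumes lc: "levi_civita A g nabla" and g: "semi_riemannian_metric A g"
    and \<eta>: "one_form A \<eta>" and Z: "Z \<in> vector_fields A"
    and dual: "\<And>W p. W \<in> vector_fields A \<Longrightarrow> \<eta> p (W p) = g p (W p) (Z p)"
    and X: "X \<in> vector_fields A" and Y: "Y \<in> vector_fields A"
  shows "ext_deriv A \<eta> X Y p = g p (nabla X Z p) (Y p) - g p (X p) (nabla Y Z p)"
proof -
  note vf = levi_civita_vector_field[OF lc]
  note tan = vector_fields_tangent
  have "\<eta> p (lie_bracket A X Y p) = g p (nabla X Y p) (Z p) - g p (nabla Y X p) (Z p)"
    using levi_civita_lie_bracket[OF lc X Y, of p]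
      one_form_diff[OF \<eta> tan[OF vf[OF X Y]] tan[OF vf[OF Y X]], of p]
      dual[OF vf[OF X Y], of p] dual[OF vf[OF Y X], of p] by simp
  moreover have "X p (\<lambda>q. \<eta> q (Y q)) = g p (nabla X Y p) (Z p) + g p (Y p) (nabla X Z p)"
    using levi_civita_metric[OF lc X Y Z, of p] by (simp add: dual[OF Y])
  moreover have "Y p (\<lambda>q. \<eta> q (X q)) = g p (nabla Y X p) (Z p) + g p (X p) (nabla Y Z p)"
    using levi_civita_metric[OF lc Y X Z, of p] by (simp add: dual[OF X])
  moreover have "g p (Y p) (nabla X Z p) = g p (nabla X Z p) (Y p)"
    using metric_sym[OF g tan[OF Y] tan[OF vf[OF X Z]]] .
  ultimately show ?thesis by (simp add: ext_deriv_def)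
qed

text \<open>
  Once the brackets are expanded, the derivatives of \<open>X\<close> and \<open>Y\<close> along \<open>Z\<close> are exactly those that
  metric compatibility gives for \<open>Z (g(X, Y))\<close>.
\<close>

lemma lie_deriv_metric_levi_civita:
  assumes lc: "levi_civita A g nabla" and g: "semi_riemannian_metric A g"
    and Z: "Z \<in> vector_fields A" and X: "X \<in> vector_fields A" and Y: "Y \<in> vector_fields A"
  shows "lie_deriv_metric A Z g X Y p = g p (nabla X Z p) (Y p) + g p (X p) (nabla Y Z p)"
proof -
  note vf = levi_civita_vector_field[OF lc]
  note tan = vector_fields_tangent
  have "g p (lie_bracket A Z X p) (Y p) = g p (nabla Z X p) (Y p) - g p (nabla X Z p) (Y p)"
    by (simp add: levi_civita_lie_bracket[OF lc Z X]
        metric_diff_left[OF g tan[OF vf[OF Z X]] tan[OF vf[OF X Z]] tan[OF Y]])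
  moreover have "g p (X p) (lie_bracket A Z Y p) = g p (X p) (nabla Z Y p) - g p (X p) (nabla Y Z p)"
  proof -
    have "lie_bracket A Z Y p \<in> tangent_space A p"
      using tangent_space_add[OF tan[OF vf[OF Z Y]] tangent_space_uminus[OF tan[OF vf[OF Y Z]]]]
      by (simp add: levi_civita_lie_bracket[OF lc Z Y])
    then have "g p (X p) (lie_bracket A Z Y p) = g p (lie_bracket A Z Y p) (X p)"
      by (rule metric_sym[OF g tan[OF X]])
    then show ?thesis
      by (simp add: levi_civita_lie_bracket[OF lc Z Y]
          metric_diff_left[OF g tan[OF vf[OF Z Y]] tan[OF vf[OF Y Z]] tan[OF X]]
          metric_sym[OF g tan[OF X] tan[OF vf[OF Z Y]]]
          metric_sym[OF g tan[OF X] tan[OF vf[OF Y Z]]])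
  qed
  ultimately show ?thesis
    using levi_civita_metric[OF lc Z X Y, of p] by (simp add: lie_deriv_metric_def)
qed

section \<open>The Reeb field of a weak almost contact B-metric structure\<close>

text \<open>
  Here \<open>\<phi>\<^sup>2 \<xi> = - Q \<xi> + \<xi> = 0\<close>. Invariance of the contact distribution puts \<open>\<phi> \<xi>\<close> into it, and there
  \<open>\<phi>\<^sup>2 = - Q\<close> is injective, while \<open>\<phi>\<^sup>2 (\<phi> \<xi>) = 0\<close>.
\<close>

lemma structure_endo_Reeb:
  assumes "weak_almost_contact A \<phi> Q \<xi> \<eta>"
  shows "\<phi> p (\<xi> p) = 0"
proof -
  have \<phi>: "tensor_field_11 A \<phi>" and Q: "tensor_field_11 A Q" and ns: "nonsingular A Q"
    and \<xi>: "\<xi> \<in> vector_fields A" and \<eta>: "one_form A \<eta>"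
    and sq: "\<And>v. v \<in> tangent_space A p \<Longrightarrow> \<phi> p (\<phi> p v) = - Q p v + \<eta> p v *\<^sub>T \<xi> p"
    and \<eta>\<xi>: "\<eta> p (\<xi> p) = 1" and Q\<xi>: "Q p (\<xi> p) = \<xi> p"
    and inv: "\<phi> p ` ker_form A \<eta> p \<subseteq> ker_form A \<eta> p"
    using assms unfolding weak_almost_contact_def by blast+
  have t\<xi>: "\<xi> p \<in> tangent_space A p"
    by (rule vector_fields_tangent[OF \<xi>])
  have t\<phi>: "\<phi> p (\<xi> p) \<in> tangent_space A p"
    using \<phi> t\<xi> unfolding tensor_field_11_def by blast
  have t0: "0 \<in> tangent_space A p"
    using tangent_space_tscale[OF t\<xi>, of 0] by (simp add: tscale_zero)
  have zero: "T p 0 = 0" if "tensor_field_11 A T" for T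
  proof -
    have "T p (0 *\<^sub>T \<xi> p) = 0 *\<^sub>T T p (\<xi> p)"
      using that t\<xi> unfolding tensor_field_11_def by blast
    then show ?thesis by (simp add: tscale_zero)
  qed
  have \<phi>\<phi>\<xi>: "\<phi> p (\<phi> p (\<xi> p)) = 0"
    using sq[OF t\<xi>] by (simp add: \<eta>\<xi> Q\<xi> tscale_def fun_eq_iff)

  define c where "c = \<eta> p (\<phi> p (\<xi> p))"
  \<comment> \<open>The component of \<open>\<phi> \<xi>\<close> in the contact distribution; its image under \<open>\<phi>\<close> is \<open>- c \<phi> \<xi>\<close>, on
    which \<open>\<eta>\<close> takes the value \<open>- c\<^sup>2\<close>.\<close>
  define u where "u = \<phi> p (\<xi> p) + (- c) *\<^sub>T \<xi> p"
  have tc: "(- c) *\<^sub>T \<xi> p \<in> tangent_space A p"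
    by (rule tangent_space_tscale[OF t\<xi>])
  have "\<eta> p u = \<eta> p (\<phi> p (\<xi> p)) + \<eta> p ((- c) *\<^sub>T \<xi> p)"
    using \<eta> t\<phi> tc unfolding u_def one_form_def by blast
  also have "\<eta> p ((- c) *\<^sub>T \<xi> p) = - c * \<eta> p (\<xi> p)"
    using \<eta> t\<xi> unfolding one_form_def by blast
  finally have "\<eta> p u = 0"
    by (simp add: \<eta>\<xi> flip: c_def)
  moreover have "u \<in> tangent_space A p"
    unfolding u_def by (rule tangent_space_add[OF t\<phi> tc])
  ultimately have "u \<in> ker_form A \<eta> p"
    by (simp add: ker_form_def)
  then have "\<eta> p (\<phi> p u) = 0"
    using inv by (auto simp: ker_form_def)
  moreover have "\<phi> p u = (- c) *\<^sub>T \<phi> p (\<xi> p)"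
  proof -
    have "\<phi> p u = \<phi> p (\<phi> p (\<xi> p)) + \<phi> p ((- c) *\<^sub>T \<xi> p)"
      using \<phi> t\<phi> tc unfolding u_def tensor_field_11_def by blast
    also have "\<phi> p ((- c) *\<^sub>T \<xi> p) = (- c) *\<^sub>T \<phi> p (\<xi> p)"
      using \<phi> t\<xi> unfolding tensor_field_11_def by blast
    finally show ?thesis by (simp add: \<phi>\<phi>\<xi>)
  qed
  moreover have "\<eta> p ((- c) *\<^sub>T \<phi> p (\<xi> p)) = - c * c"
    using \<eta> t\<phi> unfolding one_form_def c_def by blast
  ultimately have "c = 0" by simp

  then have "Q p (\<phi> p (\<xi> p)) = 0"
    using sq[OF t\<phi>] by (simp add: \<phi>\<phi>\<xi> zero[OF \<phi>] tscale_zero flip: c_def)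
  then have "Q p (\<phi> p (\<xi> p)) = Q p 0"
    by (simp add: zero[OF Q])
  then show ?thesis
    using ns t\<phi> t0 unfolding nonsingular_def bij_betw_def by (meson inj_onD)
qed

lemma form_eq_metric_Reeb:
  assumes B: "weak_almost_contact_B_metric A \<phi> Q \<xi> \<eta> g" and X: "X \<in> vector_fields A"
  shows "\<eta> p (X p) = g p (X p) (\<xi> p)"
proof -
  have wac: "weak_almost_contact A \<phi> Q \<xi> \<eta>" and g: "semi_riemannian_metric A g"
    and comp: "\<And>Y. Y \<in> vector_fields A \<Longrightarrow>
      g p (\<phi> p (X p)) (\<phi> p (Y p)) = - g p (X p) (Q p (Y p)) + \<eta> p (X p) * \<eta> p (Y p)"
    using B X unfolding weak_almost_contact_B_metric_def by blast+
  have \<xi>: "\<xi> \<in> vector_fields A" and \<phi>: "tensor_field_11 A \<phi>"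
    and \<eta>\<xi>: "\<eta> p (\<xi> p) = 1" and Q\<xi>: "Q p (\<xi> p) = \<xi> p"
    using wac unfolding weak_almost_contact_def by blast+
  have t: "\<phi> p (X p) \<in> tangent_space A p"
    using \<phi> vector_fields_tangent[OF X] unfolding tensor_field_11_def by blast
  have "\<phi> p (\<xi> p) \<in> tangent_space A p"
    using \<phi> vector_fields_tangent[OF \<xi>] unfolding tensor_field_11_def by blast
  then have "g p (\<phi> p (X p)) (\<phi> p (\<xi> p)) = g p (\<phi> p (\<xi> p)) (\<phi> p (X p))"
    by (rule metric_sym[OF g t])
  also have "\<dots> = 0"
    by (simp add: structure_endo_Reeb[OF wac] metric_zero_left[OF g t])
  finally show ?thesis
    using comp[OF \<xi>] by (simp add: \<eta>\<xi> Q\<xi>)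
qed

theorem proposition22:
  fixes A :: "('a::{t2_space, second_countable_topology}, 'e::euclidean_space) atlas"
    and n :: nat
    and \<phi> Q :: "'a endo" and \<xi> :: "'a vfield" and \<eta> :: "'a form1" and g :: "'a form2"
    and nabla :: "'a vfield \<Rightarrow> 'a vfield \<Rightarrow> 'a vfield"
  assumes "smooth_atlas A"
    and "n \<ge> 1" and "DIM('e) = 2 * n + 1"
    and "weak_almost_contact_B_metric A \<phi> Q \<xi> \<eta> g"
    and "levi_civita A g nabla"
    and "\<forall>X\<in>vector_fields A. \<forall>Y\<in>vector_fields A. \<forall>p.
           ext_deriv A \<eta> X Y p = g p (nabla X \<xi> p) (Y p)"
  shows "killing A g \<xi> \<and> parallel_distribution A nabla (ker_form A \<eta>)"
proof -
  note lc = assms(5)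
  have wac: "weak_almost_contact A \<phi> Q \<xi> \<eta>" and g: "semi_riemannian_metric A g"
    using assms(4) unfolding weak_almost_contact_B_metric_def by blast+
  have \<xi>: "\<xi> \<in> vector_fields A" and \<eta>: "one_form A \<eta>"
    using wac unfolding weak_almost_contact_def by blast+
  note dual = form_eq_metric_Reeb[OF assms(4)]
  note vf = levi_civita_vector_field[OF lc]
  have parallel: "g p (X p) (nabla Y \<xi> p) = 0"
    if "X \<in> vector_fields A" "Y \<in> vector_fields A" for X Y p
  proof -
    have "ext_deriv A \<eta> X Y p = g p (nabla X \<xi> p) (Y p) - g p (X p) (nabla Y \<xi> p)"
    proof (rule ext_deriv_metric_dual[OF lc g \<eta> \<xi> _ that])
      show "\<eta> q (W q) = g q (W q) (\<xi> q)" if "W \<in> vector_fields A" for W q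
        by (rule dual[OF that])
    qed
    then show ?thesis
      using assms(6) that by simp
  qed
  have "killing A g \<xi>"
    unfolding killing_def
  proof (intro ballI allI)
    fix X Y p
    assume X: "X \<in> vector_fields A" and Y: "Y \<in> vector_fields A"
    have "g p (nabla X \<xi> p) (Y p) = g p (Y p) (nabla X \<xi> p)"
      by (rule metric_sym[OF g vector_fields_tangent[OF vf[OF X \<xi>]] vector_fields_tangent[OF Y]])
    then show "lie_deriv_metric A \<xi> g X Y p = 0"
      by (simp add: lie_deriv_metric_levi_civita[OF lc g \<xi> X Y] parallel X Y)
  qed
  moreover have "parallel_distribution A nabla (ker_form A \<eta>)"
    unfolding parallel_distribution_def
  proof (intro ballI)
    fix X Y
    assume X: "X \<in> vector_fields A" and "Y \<in> sections A (ker_form A \<eta>)"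
    then have Y: "Y \<in> vector_fields A" and ker: "\<And>p. \<eta> p (Y p) = 0"
      by (auto simp: sections_def ker_form_def)
    have "\<eta> p (nabla X Y p) = 0" for p
    proof -
      have "X p (\<lambda>q. g q (Y q) (\<xi> q)) = 0"
        using tangent_vector_zero_fun[OF vector_fields_tangent[OF X, of p]]
        by (simp add: ker flip: dual[OF Y])
      then show ?thesis
        using levi_civita_metric[OF lc X Y \<xi>, of p]
        by (simp add: parallel[OF Y X] dual[OF vf[OF X Y]])
    qed
    then show "nabla X Y \<in> sections A (ker_form A \<eta>)"
      using vf[OF X Y] vector_fields_tangent[OF vf[OF X Y]]
      by (simp add: sections_def ker_form_def)
  qed
  ultimately show ?thesis ..
qed

end
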